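(* Let $\mathcal S\subset\mathbb R^{2n}$ satisfy Assumption 1, let $A^*$ be the chosen target polynomial and $\underline\lambda$ the largest modulus of a root of $z^{2n}A^*(z^{-1})$. Fix $\delta\in(0,\infty]$, $\lambda_1\in(\underline\lambda,1)$ and $c_0\ge0$, and let $c_1>0$ and $\varepsilon>0$ be constants having the nominal bound property (N) of the context. Then for every $\beta\in(0,1)$ and $\lambda_2\in(\max\{\lambda_1,\beta\},1)$ there exist $\bar\mu>0$ and $c_2>0$ such that for every $t_0\in\mathbb Z$, $\phi_0\in\mathbb R^{2n}$, $m_0\in\mathbb R$, $\theta_0\in\mathcal S$, $y^*,d\in\ell_\infty$, $\theta^*\in s(\mathcal S,c_0,\varepsilon)$ and $\mu\in(0,\bar\mu)$, when the adaptive controller (the estimator with parameter $\delta$ and $\hat\theta(t_0)=\theta_0$, together with the pole placement control law, as described in the context) is applied to the time-varying plant $$y(t+1)=\phi(t)^T\theta^*(t)+d(t)+d_\Delta(t),\quad \phi(t_0)=\phi_0,\quad t\ge t_0,$$ with $d_\Delta(t)\in\mathbb R$ satisfying $$m(t+1)=\beta m(t)+\beta\|\phi(t)\|,\quad m(t_0)=m_0,\qquad |d_\Delta(t)|\le\mu\, m(t)+\mu\|\phi(t)\|,\qquad t\ge t_0,$$ the following bound holds: $$\|\phi(k)\|\le c_2\lambda_2^{k-t_0}\bigl(\|\phi_0\|+|m_0|\bigr)+\sum_{j=t_0}^{k-1}c_2\lambda_2^{k-1-j}\bigl(|d(j)|+|r(j)|\bigr),\qquad k\ge t_0,$$ where $r(t)=\sum_{i=1}^n\hat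 p_i(t)\,y^*(t+1-i)$.
   Context: Norms: $\|\cdot\|$ is the Euclidean norm on vectors and the induced norm on matrices. $\ell_\infty$ (resp. $\ell_\infty(\mathbb R^{2n})$) is the set of bounded real-valued (resp. $\mathbb R^{2n}$-valued) sequences indexed by $\mathbb Z$. Signals. Fix $n\in\mathbb N$. For real sequences $y$ (output), $u$ (control input) put $\phi(t)=[y(t),\dots,y(t-n+1),u(t),\dots,u(t-n+1)]^T\in\mathbb R^{2n}$; the initial condition $\phi(t_0)=\phi_0$ specifies $y(t_0),\dots,y(t_0-n+1),u(t_0),\dots,u(t_0-n+1)$. $d$ is a disturbance and $d_\Delta$ represents the effect of unmodelled dynamics. Assumption 1 on the (fixed, known) parameter set $\mathcal S\subset\mathbb R^{2n}$: $\mathcal S$ is (nonempty) convex and compact, and for each $\theta=[-a_1,\dots,-a_n,b_1,\dots,b_n]^T\in\mathcal S$ the polynomials $A(z^{-1})=1+a_1z^{-1}+\dots+a_nz^{-n}$ and $B(z^{-1})=b_1z^{-1}+\dots+b_nz^{-n}$ are coprime, in the sense that $z^nA(z^{-1})$ and $z^nB(z^{-1})$ are coprime polynomials in $z$. Put $\|\mathcal S\|=\max_{x\in\mathcal S}\|x\|$ and let $\pi_{\mathcal S}:\mathbb R^{2n}\to\mathcal S$ be the Euclidean projection onto $\mathcal S$. Admissible time variations. For $c_0\ge0$, $\varepsilon>0$, $s(\mathcal S,c_0,\varepsilon)$ is the set of $\theta^*\in\ell_\infty(\mathbb R^{2n})$ with $\theta^*(t)\in\mathcal S$ for every $t\in\mathbb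 Z$ and $$\sum_{t=t_1}^{t_2-1}\|\theta^*(t+1)-\theta^*(t)\|\le c_0+\varepsilon(t_2-t_1)\quad\text{for all }t_1,t_2\in\mathbb Z,\ t_2>t_1.$$ Estimator. Let $\delta\in(0,\infty]$, with the convention $\infty\cdot 0=0$. Set $\hat\theta(t_0)=\theta_0\in\mathcal S$ and, for $t\ge t_0$, let $e(t+1)=y(t+1)-\phi(t)^T\hat\theta(t)$ (prediction error). Define $\rho_\delta(\phi(t),e(t+1))=1$ if $|e(t+1)|<(2\|\mathcal S\|+\delta)\|\phi(t)\|$ and $=0$ otherwise (so it is $0$ when $\phi(t)=0$). Then $$\check\theta(t+1)=\hat\theta(t)+\rho_\delta(\phi(t),e(t+1))\frac{\phi(t)}{\phi(t)^T\phi(t)}e(t+1),\qquad \hat\theta(t+1)=\pi_{\mathcal S}(\check\theta(t+1)),$$ where the update term is taken to be $0$ whenever $\rho_\delta=0$. Control law. Fix once and for all $A^*(z^{-1})=1+a_1^*z^{-1}+\dots+a_{2n}^*z^{-2n}$ such that all zeros of $z^{2n}A^*(z^{-1})$ lie in the open unit disk; $\underline\lambda=\max\{|\lambda|:\lambda\text{ a root of }z^{2n}A^*(z^{-1})\}$. Write $\hat\theta(t)=[-\hat a_1(t),\dots,-\hat a_n(t),\hat b_1(t),\dots,\hat b_n(t)]^T$, $\hat A(t,z^{-1})=1+\sum_{i=1}^n\hat a_i(t)z^{-i}$, $\hat B(t,z^{-1})=\sum_{i=1}^n\hat b_i(t)z^{-i}$, and let $\hat L(t,z^{-1})=1+\sum_{i=1}^n\hat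 l_i(t)z^{-i}$, $\hat P(t,z^{-1})=\sum_{i=1}^n\hat p_i(t)z^{-i}$ be the unique polynomials of this form with $\hat A\hat L+\hat B\hat P=A^*$. For an exogenous reference signal $y^*$ (a sequence on $\mathbb Z$), the control is, for $t\ge t_0+1$, $$u(t)=-\sum_{i=1}^n\hat l_i(t-1)u(t-i)-\sum_{i=1}^n\hat p_i(t-1)\,[y(t-i)-y^*(t-i)].$$ Property (N) of $(c_1,\varepsilon)$ (relative to $\delta,\lambda_1,c_0$): for every $t_0\in\mathbb Z$, $\theta_0\in\mathcal S$, $\theta^*\in s(\mathcal S,c_0,\varepsilon)$, $\phi_0\in\mathbb R^{2n}$ and $y^*,d\in\ell_\infty$, when this adaptive controller is applied to the plant without unmodelled dynamics $y(t+1)=\phi(t)^T\theta^*(t)+d(t)$, $\phi(t_0)=\phi_0$, $t\ge t_0$, one has $$\|\phi(k)\|\le c_1\lambda_1^{k-t_0}\|\phi_0\|+\sum_{j=t_0}^{k-1}c_1\lambda_1^{k-1-j}\bigl(|r(j)|+|d(j)|\bigr),\quad k\ge t_0.$$ It is a separate result that for every $\delta\in(0,\infty]$, $\lambda_1\in(\underline\lambda,1)$, $c_0\ge0$ such constants $c_1,\varepsilon$ exist. *)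

theory Defs
  imports
    "HOL-Analysis.Analysis"
    "HOL-Computational_Algebra.Polynomial"
begin

section \<open>Coordinates and polynomials in the delay operator\<close>

text \<open>
  The number \<open>n\<close> is \<open>CARD('n)\<close> for an arbitrary finite linearly ordered index type \<open>'n\<close>, whose
  elements are numbered \<open>1, \<dots>, n\<close> by their rank. The space of dimension \<open>2n\<close> is the product
  \<open>(real^'n) \<times> (real^'n)\<close>; the norm and inner product of the product type are the Euclidean ones.
\<close>

type_synonym 'n vec1 = "real^'n"
type_synonym 'n vec2 = "'n vec1 \<times> 'n vec1"

definition pos :: "'n::{finite,linorder} \<Rightarrow> nat"
  where "pos i = card {..i}"

lemma bij_betw_pos: "bij_betw (pos :: 'n::{finite,linorder} \<Rightarrow> nat) UNIV {1..CARD('n)}"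
proof -
  have "strict_mono (pos :: 'n \<Rightarrow> nat)"
    unfolding pos_def by (intro strict_monoI psubset_card_mono) auto
  then have inj: "inj (pos :: 'n \<Rightarrow> nat)"
    by (rule strict_mono_imp_inj_on)
  have "range (pos :: 'n \<Rightarrow> nat) \<subseteq> {1..CARD('n)}"
    by (auto simp: pos_def Suc_le_eq card_gt_0_iff intro!: card_mono)
  moreover have "card (range (pos :: 'n \<Rightarrow> nat)) = card {1..CARD('n)}"
    using inj by (simp add: card_image)
  ultimately have "range (pos :: 'n \<Rightarrow> nat) = {1..CARD('n)}"
    by (intro card_subset_eq) auto
  with inj show ?thesis
    by (simp add: bij_betw_def)
qed

text \<open>
  A polynomial in \<open>z\<^sup>-\<^sup>1\<close> is a \<open>real poly\<close> whose indeterminate stands for \<open>z\<^sup>-\<^sup>1\<close>.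
  \<open>delay_poly v\<close> is \<open>v\<^sub>1 z\<^sup>-\<^sup>1 + \<dots> + v\<^sub>n z\<^sup>-\<^sup>n\<close>.
\<close>

definition delay_poly :: "'n::{finite,linorder} vec1 \<Rightarrow> real poly"
  where "delay_poly v = (\<Sum>i\<in>UNIV. monom (v $ i) (pos i))"

text \<open>
  For \<open>degree q \<le> N\<close>, \<open>forward_poly N q\<close> is the polynomial \<open>z^N q(z\<^sup>-\<^sup>1)\<close> in the indeterminate \<open>z\<close>.
  It differs from \<^const>\<open>reflect_poly\<close> by a power of \<open>z\<close> if \<open>degree q < N\<close>.
\<close>

definition forward_poly :: "nat \<Rightarrow> real poly \<Rightarrow> real poly"
  where "forward_poly N q = (\<Sum>i\<le>N. monom (coeff q i) (N - i))"

text \<open>A parameter vector is \<open>\<theta> = (-a, b)\<close>, whence the sign in \<open>A\<close>.\<close>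

definition A_poly :: "'n::{finite,linorder} vec2 \<Rightarrow> real poly"
  where "A_poly \<theta> = 1 - delay_poly (fst \<theta>)"

definition B_poly :: "'n::{finite,linorder} vec2 \<Rightarrow> real poly"
  where "B_poly \<theta> = delay_poly (snd \<theta>)"


section \<open>Standing assumptions\<close>

definition param_set :: "'n::{finite,linorder} vec2 set \<Rightarrow> bool"
  where "param_set S \<longleftrightarrow>
    S \<noteq> {} \<and> convex S \<and> compact S \<and>
    (\<forall>\<theta>\<in>S. coprime (forward_poly CARD('n) (A_poly \<theta>)) (forward_poly CARD('n) (B_poly \<theta>)))"

definition set_norm :: "'n::{finite,linorder} vec2 set \<Rightarrow> real"
  where "set_norm S = (SUP x\<in>S. norm x)"

text \<open>The zeros, in the complex plane, of \<open>z^N q(z\<^sup>-\<^sup>1)\<close>.\<close>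

definition forward_roots :: "nat \<Rightarrow> real poly \<Rightarrow> complex set"
  where "forward_roots N q = {z. poly (map_poly complex_of_real (forward_poly N q)) z = 0}"

definition target_poly :: "nat \<Rightarrow> real poly \<Rightarrow> bool"
  where "target_poly N As \<longleftrightarrow>
    degree As \<le> N \<and> coeff As 0 = 1 \<and> (\<forall>z\<in>forward_roots N As. norm z < 1)"

definition lambda_low :: "nat \<Rightarrow> real poly \<Rightarrow> real"
  where "lambda_low N As = Max (norm ` forward_roots N As)"

definition slow_params :: "'n::{finite,linorder} vec2 set \<Rightarrow> real \<Rightarrow> real \<Rightarrow> (int \<Rightarrow> 'n vec2) set"
  where "slow_params S c0 \<epsilon> =
    {\<theta>. bounded (range \<theta>) \<and> (\<forall>t. \<theta> t \<in> S) \<and>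
        (\<forall>t1 t2. t1 < t2 \<longrightarrow>
          (\<Sum>t=t1..t2-1. norm (\<theta> (t+1) - \<theta> t)) \<le> c0 + \<epsilon> * real_of_int (t2 - t1))}"


section \<open>The adaptive closed loop\<close>

definition regressor ::
    "(int \<Rightarrow> real) \<Rightarrow> (int \<Rightarrow> real) \<Rightarrow> int \<Rightarrow> 'n::{finite,linorder} vec2"
  where "regressor y u t = (\<chi> i. y (t + 1 - int (pos i)), \<chi> i. u (t + 1 - int (pos i)))"

text \<open>
  The parameter \<open>\<delta>\<close> ranges over \<open>(0, \<infinity>]\<close>; multiplication on \<^typ>\<open>ereal\<close> satisfies \<open>\<infinity> * 0 = 0\<close>.
\<close>

definition update_on :: "'n::{finite,linorder} vec2 set \<Rightarrow> ereal \<Rightarrow> 'n vec2 \<Rightarrow> real \<Rightarrow> bool"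
  where "update_on S \<delta> \<phi> e \<longleftrightarrow> ereal \<bar>e\<bar> < (ereal (2 * set_norm S) + \<delta>) * ereal (norm \<phi>)"

definition estimate_step ::
    "'n::{finite,linorder} vec2 set \<Rightarrow> ereal \<Rightarrow> 'n vec2 \<Rightarrow> real \<Rightarrow> 'n vec2 \<Rightarrow> 'n vec2"
  where "estimate_step S \<delta> \<phi> ynext \<theta> =
    (let e = ynext - \<phi> \<bullet> \<theta>
     in closest_point S
          (\<theta> + (if update_on S \<delta> \<phi> e then (e / (\<phi> \<bullet> \<phi>)) *\<^sub>R \<phi> else 0)))"

text \<open>
  \<open>pole_placing As \<theta> l p\<close> states that \<open>L = 1 + \<Sum> l\<^sub>i z\<^sup>-\<^sup>i\<close> and \<open>P = \<Sum> p\<^sub>i z\<^sup>-\<^sup>i\<close> solve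
  \<open>A L + B P = A\<^sup>*\<close>; the solution exists and is unique for \<open>\<theta> \<in> S\<close> by coprimeness.
\<close>

definition pole_placing ::
    "real poly \<Rightarrow> 'n::{finite,linorder} vec2 \<Rightarrow> 'n vec1 \<Rightarrow> 'n vec1 \<Rightarrow> bool"
  where "pole_placing As \<theta> l p \<longleftrightarrow>
    A_poly \<theta> * (1 + delay_poly l) + B_poly \<theta> * delay_poly p = As"

text \<open>
  Signals are functions on all of \<^typ>\<open>int\<close>, constrained only from the start time \<open>t0\<close> on (and on
  the window of length \<open>n\<close> before it that is fixed by the initial regressor). \<open>w\<close> is the total
  disturbance entering the plant.
\<close>

definition closed_loop ::
    "'n::{finite,linorder} vec2 set \<Rightarrow> real poly \<Rightarrow> ereal \<Rightarrow> int \<Rightarrow> 'n vec2 \<Rightarrow> 'n vec2 \<Rightarrow>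
     (int \<Rightarrow> 'n vec2) \<Rightarrow> (int \<Rightarrow> real) \<Rightarrow> (int \<Rightarrow> real) \<Rightarrow>
     (int \<Rightarrow> real) \<Rightarrow> (int \<Rightarrow> real) \<Rightarrow> (int \<Rightarrow> 'n vec2) \<Rightarrow> (int \<Rightarrow> 'n vec1) \<Rightarrow> (int \<Rightarrow> 'n vec1) \<Rightarrow> bool"
  where "closed_loop S As \<delta> t0 \<phi>0 \<theta>0 \<theta>s ys w y u \<theta>h l p \<longleftrightarrow>
    regressor y u t0 = \<phi>0 \<and>
    (\<forall>t\<ge>t0. y (t+1) = regressor y u t \<bullet> \<theta>s t + w t) \<and>
    \<theta>h t0 = \<theta>0 \<and>
    (\<forall>t\<ge>t0. \<theta>h (t+1) = estimate_step S \<delta> (regressor y u t) (y (t+1)) (\<theta>h t)) \<and>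
    (\<forall>t\<ge>t0. pole_placing As (\<theta>h t) (l t) (p t)) \<and>
    (\<forall>t\<ge>t0+1. u t =
        - (\<Sum>i\<in>UNIV. l (t-1) $ i * u (t - int (pos i)))
        - (\<Sum>i\<in>UNIV. p (t-1) $ i * (y (t - int (pos i)) - ys (t - int (pos i)))))"

definition ref_signal :: "(int \<Rightarrow> 'n::{finite,linorder} vec1) \<Rightarrow> (int \<Rightarrow> real) \<Rightarrow> int \<Rightarrow> real"
  where "ref_signal p ys t = (\<Sum>i\<in>UNIV. p t $ i * ys (t + 1 - int (pos i)))"

text \<open>The bound on the closed loop in the absence of unmodelled dynamics.\<close>

definition nominal_bound ::
    "'n::{finite,linorder} vec2 set \<Rightarrow> real poly \<Rightarrow> ereal \<Rightarrow> real \<Rightarrow> real \<Rightarrow> real \<Rightarrow> real \<Rightarrow> bool"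
  where "nominal_bound S As \<delta> lam1 c0 c1 \<epsilon> \<longleftrightarrow>
    (\<forall>t0. \<forall>\<theta>0\<in>S. \<forall>\<theta>s\<in>slow_params S c0 \<epsilon>. \<forall>\<phi>0 ys d y u \<theta>h l p.
       bounded (range ys) \<longrightarrow> bounded (range d) \<longrightarrow>
       closed_loop S As \<delta> t0 \<phi>0 \<theta>0 \<theta>s ys d y u \<theta>h l p \<longrightarrow>
       (\<forall>k\<ge>t0. norm (regressor y u k :: 'n vec2)
          \<le> c1 * lam1 powi (k - t0) * norm \<phi>0
            + (\<Sum>j=t0..k-1. c1 * lam1 powi (k - 1 - j) * (\<bar>ref_signal p ys j\<bar> + \<bar>d j\<bar>))))"

end

theory Submission
  imports Defs
    "HOL-Computational_Algebra.Field_as_Ring"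
    "HOL-Computational_Algebra.Fundamental_Theorem_Algebra"
    "HOL-Computational_Algebra.Polynomial_Factorial"
begin

text \<open>
  With the whole of \<open>d + d\<^sub>\<Delta>\<close> regarded as the disturbance, the nominal bound is a convolution
  inequality for \<open>\<parallel>\<phi>\<parallel>\<close> whose right-hand side contains \<open>\<mu>(\<bar>m\<bar> + \<parallel>\<phi>\<parallel>)\<close>. Let \<open>s\<close> be that right-hand
  side, with decay rate \<open>\<lambda> = max \<lambda>\<^sub>1 \<beta>\<close>. It obeys a first-order recursion, and for
  \<open>\<gamma> = (\<lambda>\<^sub>2 - \<lambda>)/2\<close> and small \<open>\<mu>\<close> the function \<open>V = s + \<gamma> \<bar>m\<bar>\<close> satisfies
  \<open>V(k+1) \<le> \<lambda>\<^sub>2 V(k) + c\<^sub>1 (\<bar>d(k)\<bar> + \<bar>r(k)\<bar>)\<close>.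
  The nominal bound is only available for bounded disturbances, so to estimate \<open>\<phi>(k)\<close> one applies it to a trajectory whose disturbance is switched off from time \<open>k\<close> on;
  that trajectory exists because coprimeness makes the pole placement equation solvable at every
  future estimate.
\<close>

section \<open>Solvability of the pole placement equation\<close>

lemma pos_ge_1: "1 \<le> pos i" and pos_le_card: "pos (i::'n::{finite,linorder}) \<le> CARD('n)"
  using bij_betw_pos[where 'n='n] by (auto simp: bij_betw_def)

lemma degree_delay_poly: "degree (delay_poly (v :: 'n::{finite,linorder} vec1)) \<le> CARD('n)"
  unfolding delay_poly_def
  by (intro degree_sum_le) (auto intro: order_trans[OF degree_monom_le] pos_le_card)

lemma coeff_delay_poly_0: "coeff (delay_poly (v :: 'n::{finite,linorder} vec1)) 0 = 0"
proof -
  have nz: "pos i \<noteq> 0" for i :: 'n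
    using pos_ge_1[of i] by simp
  show ?thesis
    by (simp add: delay_poly_def coeff_sum nz)
qed

text \<open>Converts polynomial solutions back into the coefficient vectors that
  \<open>pole_placing\<close> speaks of.\<close>

lemma ex_delay_poly:
  assumes "degree q \<le> CARD('n)" "coeff q 0 = 0"
  shows "\<exists>v :: 'n::{finite,linorder} vec1. delay_poly v = q"
proof
  have "delay_poly (\<chi> i::'n. coeff q (pos i)) = (\<Sum>k\<in>{1..CARD('n)}. monom (coeff q k) k)"
    using sum.reindex_bij_betw[OF bij_betw_pos[where 'n='n], of "\<lambda>k. monom (coeff q k) k"]
    by (simp add: delay_poly_def)
  also have "\<dots> = (\<Sum>k\<le>CARD('n). monom (coeff q k) k)"
    by (rule sum.mono_neutral_left) (use assms(2) in \<open>auto simp: not_less_eq_eq\<close>)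
  also have "\<dots> = q"
    by (rule poly_as_sum_of_monoms'[OF assms(1)])
  finally show "delay_poly (\<chi> i::'n. coeff q (pos i)) = q" .
qed

lemma coeff_forward_poly:
  "coeff (forward_poly N q) k = (if k \<le> N then coeff q (N - k) else 0)"
proof -
  have "coeff (forward_poly N q) k = (\<Sum>i\<le>N. if N - i = k then coeff q i else 0)"
    by (simp add: forward_poly_def coeff_sum)
  also have "\<dots> = (\<Sum>i\<le>N. if k \<le> N \<and> i = N - k then coeff q i else 0)"
    by (rule sum.cong) auto
  also have "\<dots> = (if k \<le> N then coeff q (N - k) else 0)"
    by (cases "k \<le> N") auto
  finally show ?thesis .
qed

lemma degree_forward_poly: "degree (forward_poly N q) \<le> N"
  by (rule degree_le) (simp add: coeff_forward_poly)

text \<open>Reversing the coefficients 0 to N twice restores them; those above N are cut off, whence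
  the degree bound.\<close>

lemma forward_poly_involution:
  assumes "degree q \<le> N"
  shows "forward_poly N (forward_poly N q) = q"
  using assms by (intro poly_eqI) (auto simp: coeff_forward_poly coeff_eq_0)

lemma forward_poly_add: "forward_poly N (p + q) = forward_poly N p + forward_poly N q"
  by (intro poly_eqI) (simp add: coeff_forward_poly)

lemma poly_forward_poly:
  assumes "degree q \<le> N" "z \<noteq> 0"
  shows "poly (forward_poly N q) z = z ^ N * poly q (1 / z)"
proof -
  have "poly (forward_poly N q) z = (\<Sum>i\<le>N. coeff q i * z ^ (N - i))"
    by (simp add: forward_poly_def poly_sum poly_monom)
  also have "\<dots> = (\<Sum>i\<le>N. z ^ N * (coeff q i * (1 / z) ^ i))"
    by (rule sum.cong) (use assms(2) in \<open>auto simp: power_diff power_one_over\<close>)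
  also have "\<dots> = z ^ N * poly q (1 / z)"
    using arg_cong[OF poly_as_sum_of_monoms'[OF assms(1)], of "\<lambda>p. poly p (1 / z)"]
    by (simp add: poly_sum poly_monom flip: sum_distrib_left)
  finally show ?thesis .
qed

lemma forward_poly_mult:
  assumes "degree p \<le> N" "degree q \<le> M"
  shows "forward_poly (N + M) (p * q) = forward_poly N p * forward_poly M q"
proof -
  have "degree (p * q) \<le> N + M"
    using degree_mult_le[of p q] assms by linarith
  \<comment> \<open>The evaluation formula says nothing at z = 0. The factor z contributed by
    \<open>pCons 0\<close> makes both sides vanish there, so they agree at every point; the factor
    is then cancelled.\<close>
  then have "poly (pCons 0 (forward_poly (N + M) (p * q))) z
      = poly (pCons 0 (forward_poly N p * forward_poly M q)) z" for z
    using assms by (cases "z = 0") (auto simp: poly_forward_poly power_add)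
  then have "pCons 0 (forward_poly (N + M) (p * q)) = pCons 0 (forward_poly N p * forward_poly M q)"
    by (simp only: poly_eq_poly_eq_iff[symmetric] fun_eq_iff) simp
  then show ?thesis
    by simp
qed

text \<open>Coprimeness concerns polynomials in z, so the equation is solved there as a X + b Y = c
  and carried back by reversing coefficients. A Bezout identity times c gives a solution; reducing Y
  modulo a gives one with the degrees that L and P require.\<close>

lemma ex_pole_placing:
  fixes \<theta> :: "'n::{finite,linorder} vec2"
  assumes S: "param_set S" and \<theta>: "\<theta> \<in> S" and As: "target_poly (2 * CARD('n)) As"
  shows "\<exists>l p. pole_placing As \<theta> l p"
proof -
  define N where "N = CARD('n)"
  define a b c where "a = forward_poly N (A_poly \<theta>)" and "b = forward_poly N (B_poly \<theta>)"
    and "c = forward_poly (2 * N) As"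
  have N: "0 < N"
    by (simp add: N_def)
  have dA: "degree (A_poly \<theta>) \<le> N" and dB: "degree (B_poly \<theta>) \<le> N"
    by (auto simp: A_poly_def B_poly_def N_def degree_delay_poly intro!: degree_diff_le)
  have A0: "coeff (A_poly \<theta>) 0 = 1" and B0: "coeff (B_poly \<theta>) 0 = 0"
    by (auto simp: A_poly_def B_poly_def coeff_delay_poly_0)
  have dAs: "degree As \<le> 2 * N" and As0: "coeff As 0 = 1"
    using As by (auto simp: target_poly_def N_def)
  have "coprime a b"
    using S \<theta> by (auto simp: param_set_def a_def b_def N_def)
  then obtain x0 y0 where xy: "x0 * a + y0 * b = 1"
    using bezout_coefficients_fst_snd[of a b] by (auto simp: coprime_iff_gcd_eq_1)
  \<comment> \<open>The constant coefficient 1 of A becomes the leading coefficient of a, so the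
    degree is exactly N.\<close>
  have da: "degree a = N"
    by (rule antisym) (auto simp: a_def degree_forward_poly coeff_forward_poly A0 intro!: le_degree)
  have "a \<noteq> 0"
    using da N by auto
  \<comment> \<open>X takes up the quotient, times b, that is discarded when \<open>y0 * c\<close>
    is reduced modulo a.\<close>
  define X Y where "X = x0 * c + (y0 * c div a) * b" and "Y = (y0 * c) mod a"
  have dY: "degree Y < N"
    using degree_mod_less'[of a "y0 * c"] da N \<open>a \<noteq> 0\<close>
    by (cases "Y = 0") (auto simp: Y_def)
  have "a * X + b * Y = (x0 * a) * c + b * ((y0 * c div a) * a + (y0 * c) mod a)"
    unfolding X_def Y_def by algebra
  also have "\<dots> = (x0 * a + y0 * b) * c"
    unfolding div_mult_mod_eq by algebra
  finally have XY: "a * X + b * Y = c"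
    using xy by simp
  have dX: "degree X \<le> N"
  proof (cases "X = 0")
    case False
    have "degree (b * Y) \<le> 2 * N"
      using degree_mult_le[of b Y] degree_forward_poly[of N "B_poly \<theta>"] dY by (simp add: b_def)
    moreover have "degree c \<le> 2 * N"
      by (simp add: c_def degree_forward_poly)
    moreover have "a * X = c - b * Y"
      using XY by (simp add: algebra_simps)
    ultimately have "degree (a * X) \<le> 2 * N"
      by (simp add: degree_diff_le)
    then show ?thesis
      using False \<open>a \<noteq> 0\<close> da by (simp add: degree_mult_eq)
  qed simp
  define L P where "L = forward_poly N X" and "P = forward_poly N Y"
  have "As = forward_poly (N + N) (a * X + b * Y)"
    using dAs by (simp add: XY c_def forward_poly_involution flip: mult_2)
  also have "\<dots> = A_poly \<theta> * L + B_poly \<theta> * P"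
    using forward_poly_mult[of a N X N] forward_poly_mult[of b N Y N] dX dY dA dB
    by (simp add: forward_poly_add a_def b_def L_def P_def degree_forward_poly
        forward_poly_involution)
  finally have eq: "A_poly \<theta> * L + B_poly \<theta> * P = As"
    by simp
  \<comment> \<open>At 1/z = 0 the factor A equals 1 and B vanishes, so L has the constant
    coefficient 1 of the target and L - 1 is a delay polynomial.\<close>
  have "coeff As 0 = coeff L 0"
    by (simp add: A0 B0 coeff_mult_0 flip: eq)
  moreover have "degree (L - 1) \<le> CARD('n)"
    by (auto simp: L_def degree_forward_poly N_def intro!: degree_diff_le)
  ultimately obtain l :: "'n vec1" where l: "delay_poly l = L - 1"
    using ex_delay_poly[of "L - 1", where 'n='n] As0 by auto
  \<comment> \<open>This is coefficient N of Y, which vanishes because Y has degree strictly below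
    N.\<close>
  have "coeff P 0 = 0"
    using dY by (simp add: P_def coeff_forward_poly coeff_eq_0)
  then obtain p :: "'n vec1" where p: "delay_poly p = P"
    using ex_delay_poly[of P, where 'n='n] by (auto simp: P_def degree_forward_poly N_def)
  have "pole_placing As \<theta> l p"
    using eq by (simp add: pole_placing_def l p)
  then show ?thesis
    by blast
qed

text \<open>\<open>Max\<close> is informative only on a finite nonempty set: the coefficient 1 at
  z^N makes the polynomial nonconstant, so it has at least one and only finitely many zeros. This
  later yields \<open>0 < lam1\<close>.\<close>

lemma lambda_low_nonneg:
  assumes As: "target_poly N As" and N: "0 < N"
  shows "0 \<le> lambda_low N As"
proof -
  define q where "q = map_poly complex_of_real (forward_poly N As)"
  have "coeff q N = 1"
    using As by (simp add: q_def coeff_map_poly coeff_forward_poly target_poly_def)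
  then have "q \<noteq> 0" "degree q \<noteq> 0"
    using N le_degree[of q N] by auto
  then obtain z where "poly q z = 0"
    using fundamental_theorem_of_algebra[of q] by (auto simp: constant_degree)
  then have "z \<in> forward_roots N As"
    by (simp add: forward_roots_def q_def)
  moreover have "finite (forward_roots N As)"
    using poly_roots_finite[OF \<open>q \<noteq> 0\<close>] by (simp add: forward_roots_def q_def)
  ultimately have "norm z \<le> lambda_low N As"
    unfolding lambda_low_def by (intro Max_ge) auto
  then show ?thesis
    using norm_ge_zero[of z] by linarith
qed


section \<open>Switching the disturbance off\<close>

lemma regressor_cong:
  assumes "\<And>s. s \<le> t \<Longrightarrow> y s = y' s" "\<And>s. s \<le> t \<Longrightarrow> u s = u' s"
  shows "(regressor y u t :: 'n::{finite,linorder} vec2) = regressor y' u' t"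
proof -
  have "t + 1 - int (pos i) \<le> t" for i :: 'n
    using pos_ge_1[of i] by simp
  then show ?thesis
    using assms by (simp add: regressor_def vec_eq_iff)
qed

lemma estimate_step_in:
  assumes "param_set S"
  shows "estimate_step S \<delta> \<phi> ynext \<theta> \<in> S"
  using assms unfolding estimate_step_def param_set_def Let_def
  by (intro closest_point_in_set) (auto intro: compact_imp_closed)

lemma closed_loop_estimate_in:
  assumes "param_set S" "\<theta>0 \<in> S" "closed_loop S As \<delta> t0 \<phi>0 \<theta>0 \<theta>s ys w y u \<theta>h l p" "t0 \<le> t"
  shows "\<theta>h t \<in> S"
proof (cases "t = t0")
  case False
  then have "t0 \<le> t - 1"
    using assms(4) by simp
  then have "\<theta>h (t - 1 + 1) \<in> S"
    using assms(3) estimate_step_in[OF assms(1)] unfolding closed_loop_def by metis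
  then show ?thesis
    by simp
qed (use assms in \<open>auto simp: closed_loop_def\<close>)

text \<open>The trajectory is kept up to time k and continued by simulating the loop without
  disturbance. The sample y(k) is driven by w(k-1), so w has to survive exactly below k. From k on
  the gains are chosen afresh, so \<open>p'\<close> agrees with \<open>p\<close> only before
  k.\<close>

lemma closed_loop_truncate:
  fixes S :: "'n::{finite,linorder} vec2 set"
  assumes S: "param_set S" and As: "target_poly (2 * CARD('n)) As" and \<theta>0: "\<theta>0 \<in> S"
    and cl: "closed_loop S As \<delta> t0 \<phi>0 \<theta>0 \<theta>s ys w y u \<theta>h l p" and k: "t0 \<le> k"
  obtains y' u' \<theta>h' l' p' where
    "closed_loop S As \<delta> t0 \<phi>0 \<theta>0 \<theta>s ys (\<lambda>t. if t0 \<le> t \<and> t < k then w t else 0) y' u' \<theta>h' l' p'"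
    "(regressor y' u' k :: 'n vec2) = regressor y u k"
    "\<And>t. t < k \<Longrightarrow> p' t = p t"
proof -
  \<comment> \<open>Gains for the simulated times, as a function of the estimate. Projection keeps
    every estimate in S, where the equation is solvable.\<close>
  define F where "F \<theta> = (SOME lp. pole_placing As \<theta> (fst lp) (snd lp))" for \<theta> :: "'n vec2"
  have F: "pole_placing As \<theta> (fst (F \<theta>)) (snd (F \<theta>))" if \<theta>: "\<theta> \<in> S" for \<theta>
  proof -
    obtain l p where "pole_placing As \<theta> l p"
      using ex_pole_placing[OF S \<theta> As] by blast
    then show ?thesis
      unfolding F_def
      using someI[of "\<lambda>lp. pole_placing As \<theta> (fst lp) (snd lp)" "(l, p)"] by simp
  qed
  \<comment> \<open>The state consists of both complete signals and the current estimate. A step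
    fills in sample t + 1; its input uses the gains of the estimate at t, matching the delay in the
    control law.\<close>
  define step where "step t = (\<lambda>(Y, U, \<theta>).
     let y1 = regressor Y U t \<bullet> \<theta>s t in
     (Y(t + 1 := y1),
      U(t + 1 := - (\<Sum>i\<in>UNIV. fst (F \<theta>) $ i * U (t + 1 - int (pos i)))
                 - (\<Sum>i\<in>UNIV. snd (F \<theta>) $ i * (Y (t + 1 - int (pos i)) - ys (t + 1 - int (pos i))))),
      estimate_step S \<delta> (regressor Y U t) y1 \<theta>))" for t
  define X where "X = rec_nat (y, u, \<theta>h k) (\<lambda>i. step (k + int i))"
  have X0: "X 0 = (y, u, \<theta>h k)" and XS: "X (Suc i) = step (k + int i) (X i)" for i
    by (auto simp: X_def)
  define Y U \<Theta> where "Y i = fst (X i)" and "U i = fst (snd (X i))" and "\<Theta> i = snd (snd (X i))" for i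
  have YS: "Y (Suc i) = (Y i)(k + int i + 1 := regressor (Y i) (U i) (k + int i) \<bullet> \<theta>s (k + int i))"
    and US: "U (Suc i) = (U i)(k + int i + 1 :=
       - (\<Sum>j\<in>UNIV. fst (F (\<Theta> i)) $ j * U i (k + int i + 1 - int (pos j)))
       - (\<Sum>j\<in>UNIV. snd (F (\<Theta> i)) $ j *
            (Y i (k + int i + 1 - int (pos j)) - ys (k + int i + 1 - int (pos j)))))"
    and \<Theta>S: "\<Theta> (Suc i) = estimate_step S \<delta> (regressor (Y i) (U i) (k + int i))
              (regressor (Y i) (U i) (k + int i) \<bullet> \<theta>s (k + int i)) (\<Theta> i)" for i
    by (simp_all add: Y_def U_def \<Theta>_def XS step_def Let_def split_beta)
  have Y0: "Y 0 = y" and U0: "U 0 = u" and \<Theta>0: "\<Theta> 0 = \<theta>h k"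
    by (simp_all add: Y_def U_def \<Theta>_def X0)
  \<comment> \<open>Sample k + i + 1 is written only in passing from stage i to stage i + 1, so
    samples up to k + i are final from stage i on.\<close>
  have Y_stable: "Y (i + j) t = Y i t" and U_stable: "U (i + j) t = U i t"
    if "t \<le> k + int i" for i j t
    using that by (induction j) (auto simp: YS US)
  \<comment> \<open>Diagonal reading: sample t comes from the first stage at which it is final. For
    t \<le> k, \<open>nat\<close> gives stage 0, the original signals.\<close>
  define y' u' \<theta>h' where "y' t = Y (nat (t - k)) t" and "u' t = U (nat (t - k)) t"
    and "\<theta>h' t = (if t < k then \<theta>h t else \<Theta> (nat (t - k)))" for t
  define l' p' where "l' t = (if t < k then l t else fst (F (\<theta>h' t)))"
    and "p' t = (if t < k then p t else snd (F (\<theta>h' t)))" for t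
  have y'_eq: "y' t = Y i t" and u'_eq: "u' t = U i t" if "t \<le> k + int i" for t i
    using that Y_stable[of t "nat (t - k)" "i - nat (t - k)"]
      U_stable[of t "nat (t - k)" "i - nat (t - k)"]
    by (auto simp: y'_def u'_def)
  have reg: "(regressor y' u' (k + int i) :: 'n vec2) = regressor (Y i) (U i) (k + int i)" for i
    by (rule regressor_cong) (auto simp: y'_eq u'_eq)
  have y'_old: "y' t = y t" and u'_old: "u' t = u t" if "t \<le> k" for t
    using that y'_eq[of t 0] u'_eq[of t 0] by (simp_all add: Y0 U0)
  have reg_old: "(regressor y' u' t :: 'n vec2) = regressor y u t" if "t \<le> k" for t
    by (rule regressor_cong) (use that in \<open>auto simp: y'_old u'_old\<close>)
  have \<theta>h'_old: "\<theta>h' t = \<theta>h t" if "t \<le> k" for t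
    using that by (auto simp: \<theta>h'_def \<Theta>0)
  have \<Theta>_in: "\<Theta> i \<in> S" for i
  proof (cases i)
    case 0
    then show ?thesis
      using closed_loop_estimate_in[OF S \<theta>0 cl k] by (simp add: \<Theta>0)
  qed (simp add: \<Theta>S estimate_step_in[OF S])
  have old_or_new: "t < k \<or> (\<exists>i. t = k + int i)" for t
    by (metis linorder_not_less zle_iff_zadd)
  have u_eq: "u t =
        - (\<Sum>i\<in>UNIV. l (t-1) $ i * u (t - int (pos i)))
        - (\<Sum>i\<in>UNIV. p (t-1) $ i * (y (t - int (pos i)) - ys (t - int (pos i))))"
    if "t0 + 1 \<le> t" for t
    using cl that unfolding closed_loop_def by blast
  have y_new: "y' (t + 1) = regressor y' u' t \<bullet> \<theta>s t + (if t0 \<le> t \<and> t < k then w t else 0)"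
    if "t0 \<le> t" for t
    using old_or_new[of t]
  proof (elim disjE exE)
    assume "t < k"
    then show ?thesis
      using cl that by (auto simp: closed_loop_def reg_old y'_old)
  next
    fix i assume t: "t = k + int i"
    have "y' (t + 1) = Y (Suc i) (t + 1)"
      by (rule y'_eq) (simp add: t)
    then show ?thesis
      by (simp add: t YS reg)
  qed
  have \<theta>_new: "\<theta>h' (t + 1) = estimate_step S \<delta> (regressor y' u' t) (y' (t + 1)) (\<theta>h' t)"
    if "t0 \<le> t" for t
    using old_or_new[of t]
  proof (elim disjE exE)
    assume "t < k"
    then show ?thesis
      using cl that by (auto simp: closed_loop_def reg_old y'_old \<theta>h'_old)
  next
    fix i assume t: "t = k + int i"
    have "nat (int i + 1) = Suc i"
      by simp
    then show ?thesis
      using y_new[OF that] by (simp add: t reg \<theta>h'_def \<Theta>S)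
  qed
  have pp_new: "pole_placing As (\<theta>h' t) (l' t) (p' t)" if "t0 \<le> t" for t
    using cl that F[OF \<Theta>_in] by (auto simp: closed_loop_def l'_def p'_def \<theta>h'_def)
  \<comment> \<open>The case split is on t - 1, the time whose gains enter u(t): the input at time k
    still belongs to the old run.\<close>
  have u_new: "u' t =
        - (\<Sum>i\<in>UNIV. l' (t-1) $ i * u' (t - int (pos i)))
        - (\<Sum>i\<in>UNIV. p' (t-1) $ i * (y' (t - int (pos i)) - ys (t - int (pos i))))"
    if "t0 + 1 \<le> t" for t
    using old_or_new[of "t - 1"]
  proof (elim disjE exE)
    assume "t - 1 < k"
    then show ?thesis
      using u_eq[OF that] by (simp add: l'_def p'_def y'_old u'_old)
  next
    fix i assume "t - 1 = k + int i"
    then have t: "t = k + int i + 1"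
      by simp
    have "t - int (pos j) \<le> k + int i" for j :: 'n
      using pos_ge_1[of j] by (simp add: t)
    then have "y' (t - int (pos j)) = Y i (t - int (pos j))"
      "u' (t - int (pos j)) = U i (t - int (pos j))" for j :: 'n
      by (simp_all add: y'_eq u'_eq)
    moreover have "u' t = U (Suc i) t"
      by (rule u'_eq) (simp add: t)
    moreover have "l' (t - 1) = fst (F (\<Theta> i))" "p' (t - 1) = snd (F (\<Theta> i))"
      by (simp_all add: t l'_def p'_def \<theta>h'_def)
    ultimately show ?thesis
      by (simp add: US t)
  qed
  show ?thesis
  proof (rule that)
    show "closed_loop S As \<delta> t0 \<phi>0 \<theta>0 \<theta>s ys (\<lambda>t. if t0 \<le> t \<and> t < k then w t else 0) y' u' \<theta>h' l' p'"
      unfolding closed_loop_def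
    proof (intro conjI allI impI y_new \<theta>_new pp_new u_new)
      show "regressor y' u' t0 = \<phi>0" "\<theta>h' t0 = \<theta>0"
        using cl k by (auto simp: closed_loop_def reg_old \<theta>h'_old)
    qed
    show "(regressor y' u' k :: 'n vec2) = regressor y u k"
      by (rule reg_old) simp
    show "p' t = p t" if "t < k" for t
      using that by (simp add: p'_def)
  qed
qed

text \<open>Meant for d plus the unmodelled dynamics, whose size is controlled only through the
  regressor still to be estimated. The bound at time k reads the disturbance and the gains only
  before k, where the truncated run has the same ones.\<close>

lemma nominal_bound_arbitrary_disturbance:
  fixes S :: "'n::{finite,linorder} vec2 set"
  assumes S: "param_set S" and As: "target_poly (2 * CARD('n)) As" and \<theta>0: "\<theta>0 \<in> S"
    and nom: "nominal_bound S As \<delta> lam c0 c1 \<epsilon>" and \<theta>s: "\<theta>s \<in> slow_params S c0 \<epsilon>"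
    and ys: "bounded (range ys)"
    and cl: "closed_loop S As \<delta> t0 \<phi>0 \<theta>0 \<theta>s ys w y u \<theta>h l p" and k: "t0 \<le> k"
  shows "norm (regressor y u k :: 'n vec2)
          \<le> c1 * lam powi (k - t0) * norm \<phi>0
            + (\<Sum>j=t0..k-1. c1 * lam powi (k - 1 - j) * (\<bar>ref_signal p ys j\<bar> + \<bar>w j\<bar>))"
proof -
  define w' where "w' t = (if t0 \<le> t \<and> t < k then w t else 0)" for t
  obtain y' u' \<theta>h' l' p' where cl': "closed_loop S As \<delta> t0 \<phi>0 \<theta>0 \<theta>s ys w' y' u' \<theta>h' l' p'"
    and reg: "(regressor y' u' k :: 'n vec2) = regressor y u k"
    and p': "\<And>t. t < k \<Longrightarrow> p' t = p t"
    using closed_loop_truncate[OF S As \<theta>0 cl k] unfolding w'_def by blast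
  \<comment> \<open>The truncated disturbance takes finitely many values, hence is bounded.\<close>
  have "range w' \<subseteq> insert 0 (w ` {t0..k})"
    by (auto simp: w'_def)
  then have "bounded (range w')"
    by (rule bounded_subset[rotated]) (simp add: finite_imp_bounded)
  then have "norm (regressor y' u' k :: 'n vec2)
          \<le> c1 * lam powi (k - t0) * norm \<phi>0
            + (\<Sum>j=t0..k-1. c1 * lam powi (k - 1 - j) * (\<bar>ref_signal p' ys j\<bar> + \<bar>w' j\<bar>))"
    using nom \<theta>0 \<theta>s ys cl' k unfolding nominal_bound_def by blast
  also have "(\<Sum>j=t0..k-1. c1 * lam powi (k - 1 - j) * (\<bar>ref_signal p' ys j\<bar> + \<bar>w' j\<bar>))
      = (\<Sum>j=t0..k-1. c1 * lam powi (k - 1 - j) * (\<bar>ref_signal p ys j\<bar> + \<bar>w j\<bar>))"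
    by (rule sum.cong) (auto simp: w'_def p' ref_signal_def)
  finally show ?thesis
    by (simp add: reg)
qed


section \<open>A discrete small gain argument\<close>

lemma sum_int_shift: "(\<Sum>j=t0..t0 + int k - 1. f j) = (\<Sum>i<k. f (t0 + int i))"
proof (rule sum.reindex_bij_witness[of _ "\<lambda>i. t0 + int i" "\<lambda>j. nat (j - t0)"])
qed auto

text \<open>The two conditions on \<mu> come from comparing coefficients in V(k+1) \<le>
  \<open>lam2\<close> V(k) + c R(k). For s one needs
  \<open>lam + c * \<mu> + \<gamma> \<le> lam2\<close>, for b one needs
  \<open>c * \<mu> + \<gamma> * lam \<le> \<gamma> * lam2\<close>.\<close>

lemma discrete_gronwall_coupled:
  fixes a b R :: "nat \<Rightarrow> real"
  assumes \<gamma>: "0 < \<gamma>" and c: "0 < c" and lam: "0 \<le> lam" and lam2: "lam2 = lam + 2 * \<gamma>"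
    and \<mu>: "0 < \<mu>" "c * \<mu> \<le> \<gamma>" "c * \<mu> \<le> 2 * \<gamma>\<^sup>2"
    and a: "\<And>k. a k \<le> c * lam ^ k * a0 + (\<Sum>j<k. c * lam ^ (k - 1 - j) * (R j + \<mu> * (a j + b j)))"
    and b: "\<And>k. 0 \<le> b k" "\<And>k. b (Suc k) \<le> lam * b k + a k"
    and a_nonneg: "\<And>k. 0 \<le> a k"
  shows "a k \<le> lam2 ^ k * (c * a0 + \<gamma> * b 0) + (\<Sum>j<k. c * lam2 ^ (k - 1 - j) * R j)"
proof -
  define s where
    "s k = c * lam ^ k * a0 + (\<Sum>j<k. c * lam ^ (k - 1 - j) * (R j + \<mu> * (a j + b j)))" for k
  have as: "a k \<le> s k" for k
    using a by (simp add: s_def)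
  \<comment> \<open>The base x is left general: it is \<open>lam\<close> in the recursion for s and
    \<open>lam2\<close> in the final induction.\<close>
  have unroll: "(\<Sum>j<Suc k. c * x ^ (Suc k - 1 - j) * g j)
      = x * (\<Sum>j<k. c * x ^ (k - 1 - j) * g j) + c * g k" for x :: real and g k
  proof -
    have "x ^ (k - j) = x * x ^ (k - 1 - j)" if "j < k" for j
      using that by (simp add: Suc_diff_Suc flip: power_Suc)
    then show ?thesis
      by (simp add: sum_distrib_left mult_ac)
  qed
  have sS: "s (Suc k) = lam * s k + c * (R k + \<mu> * (a k + b k))" for k
    unfolding s_def unroll by (simp add: algebra_simps)
  have V: "s (Suc k) + \<gamma> * b (Suc k) \<le> lam2 * (s k + \<gamma> * b k) + c * R k" for k
  proof -
    have s0: "0 \<le> s k"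
      using as a_nonneg order_trans by blast
    have "c * \<mu> * a k \<le> c * \<mu> * s k"
      using as c \<mu> by (intro mult_left_mono) auto
    moreover have "\<gamma> * b (Suc k) \<le> \<gamma> * (lam * b k + s k)"
      using b(2)[of k] as[of k] \<gamma> by (intro mult_left_mono) auto
    moreover have "c * \<mu> * s k \<le> \<gamma> * s k"
      using \<mu> s0 by (intro mult_right_mono)
    moreover have "c * \<mu> * b k \<le> 2 * \<gamma>\<^sup>2 * b k"
      using \<mu> b(1) by (intro mult_right_mono)
    ultimately show ?thesis
      unfolding sS lam2 by (simp add: algebra_simps power2_eq_square)
  qed
  have *: "s k + \<gamma> * b k \<le> lam2 ^ k * (c * a0 + \<gamma> * b 0) + (\<Sum>j<k. c * lam2 ^ (k - 1 - j) * R j)" for k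
  proof (induction k)
    case (Suc k)
    have "0 \<le> lam2"
      using lam lam2 \<gamma> by simp
    note V[of k]
    also have "lam2 * (s k + \<gamma> * b k) \<le>
        lam2 * (lam2 ^ k * (c * a0 + \<gamma> * b 0) + (\<Sum>j<k. c * lam2 ^ (k - 1 - j) * R j))"
      by (rule mult_left_mono[OF Suc \<open>0 \<le> lam2\<close>])
    finally show ?case
      unfolding unroll by (simp add: algebra_simps)
  qed (simp add: s_def)
  have "0 \<le> \<gamma> * b k"
    using \<gamma> b(1) by simp
  then show ?thesis
    using as[of k] *[of k] by linarith
qed

theorem theorem3:
  fixes S :: "'n::{finite,linorder} vec2 set"
    and As :: "real poly"
    and \<delta> :: ereal
    and lam1 lam2 c0 c1 \<epsilon> \<beta> :: real
  assumes "param_set S"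
    and "target_poly (2 * CARD('n)) As"
    and "0 < \<delta>"
    and "lambda_low (2 * CARD('n)) As < lam1" and "lam1 < 1"
    and "0 \<le> c0"
    and "0 < c1" and "0 < \<epsilon>"
    and "nominal_bound S As \<delta> lam1 c0 c1 \<epsilon>"
    and "0 < \<beta>" and "\<beta> < 1"
    and "max lam1 \<beta> < lam2" and "lam2 < 1"
  shows "\<exists>\<mu>bar>0. \<exists>c2>0.
    \<forall>(t0::int) (\<phi>0::'n vec2) (m0::real). \<forall>\<theta>0\<in>S.
    \<forall>(ys::int \<Rightarrow> real) (d::int \<Rightarrow> real). bounded (range ys) \<longrightarrow> bounded (range d) \<longrightarrow>
    (\<forall>\<theta>s\<in>slow_params S c0 \<epsilon>. \<forall>\<mu>::real. 0 < \<mu> \<longrightarrow> \<mu> < \<mu>bar \<longrightarrow>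
      (\<forall>d\<Delta> m y u \<theta>h l p.
         closed_loop S As \<delta> t0 \<phi>0 \<theta>0 \<theta>s ys (\<lambda>t. d t + d\<Delta> t) y u \<theta>h l p \<longrightarrow>
         m t0 = m0 \<longrightarrow>
         (\<forall>t\<ge>t0. m (t+1) = \<beta> * m t + \<beta> * norm (regressor y u t :: 'n vec2)) \<longrightarrow>
         (\<forall>t\<ge>t0. \<bar>d\<Delta> t\<bar> \<le> \<mu> * m t + \<mu> * norm (regressor y u t :: 'n vec2)) \<longrightarrow>
         (\<forall>k\<ge>t0. norm (regressor y u k :: 'n vec2)
            \<le> c2 * lam2 powi (k - t0) * (norm \<phi>0 + \<bar>m0\<bar>)
              + (\<Sum>j=t0..k-1. c2 * lam2 powi (k - 1 - j) * (\<bar>d j\<bar> + \<bar>ref_signal p ys j\<bar>)))))"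
proof -
  define lam where "lam = max lam1 \<beta>"
  \<comment> \<open>Half of the gap between the rates: one half absorbs the feedback through \<mu>,
    the other the term by which the regressor drives m.\<close>
  define \<gamma> where "\<gamma> = (lam2 - lam) / 2"
  \<comment> \<open>Chosen so that \<mu> below it satisfies both smallness conditions of
    \<open>discrete_gronwall_coupled\<close>.\<close>
  define \<mu>bar where "\<mu>bar = min \<gamma> (2 * \<gamma>\<^sup>2) / c1"
  have lam1: "0 < lam1"
    using lambda_low_nonneg[OF assms(2)] assms(4) by simp
  have \<gamma>: "0 < \<gamma>" and lam: "0 < lam" and lam2_eq: "lam2 = lam + 2 * \<gamma>"
    using assms lam1 by (auto simp: \<gamma>_def lam_def field_simps)
  have \<mu>bar: "0 < \<mu>bar"
    using \<gamma> assms(7) by (simp add: \<mu>bar_def)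
  \<comment> \<open>The witness for \<open>c2\<close> is \<open>c1 + \<gamma>\<close>: it dominates
    both weights in the initial value \<open>c1 * norm \<phi>0 + \<gamma> * \<bar>m0\<bar>\<close>
    and the factor \<open>c1\<close> in the sum.\<close>
  have main: "norm (regressor y u k :: 'n vec2)
            \<le> (c1 + \<gamma>) * lam2 powi (k - t0) * (norm \<phi>0 + \<bar>m0\<bar>)
              + (\<Sum>j=t0..k-1. (c1 + \<gamma>) * lam2 powi (k - 1 - j) * (\<bar>d j\<bar> + \<bar>ref_signal p ys j\<bar>))"
    if \<theta>0: "\<theta>0 \<in> S" and ys: "bounded (range ys)" and \<theta>s: "\<theta>s \<in> slow_params S c0 \<epsilon>"
      and \<mu>: "0 < \<mu>" "\<mu> < \<mu>bar"
      and cl: "closed_loop S As \<delta> t0 \<phi>0 \<theta>0 \<theta>s ys (\<lambda>t. d t + d\<Delta> t) y u \<theta>h l p"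
      and m0: "m t0 = m0"
      and m: "\<forall>t\<ge>t0. m (t+1) = \<beta> * m t + \<beta> * norm (regressor y u t :: 'n vec2)"
      and d\<Delta>: "\<forall>t\<ge>t0. \<bar>d\<Delta> t\<bar> \<le> \<mu> * m t + \<mu> * norm (regressor y u t :: 'n vec2)"
      and k: "t0 \<le> k"
    for t0 :: int and \<phi>0 :: "'n vec2" and m0 \<theta>0 ys d \<theta>s \<mu> d\<Delta> m y u \<theta>h l p k
  proof -
    \<comment> \<open>Since m0 may be negative, b records the absolute value of m.\<close>
    define a b R where "a i = norm (regressor y u (t0 + int i) :: 'n vec2)"
      and "b i = \<bar>m (t0 + int i)\<bar>"
      and "R i = \<bar>d (t0 + int i)\<bar> + \<bar>ref_signal p ys (t0 + int i)\<bar>" for i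
    \<comment> \<open>For j < i the integer exponent is nonnegative and agrees with truncated
      subtraction.\<close>
    have powi: "x powi (t0 + int i - 1 - (t0 + int j)) = x ^ (i - 1 - j)" if "j < i"
      for x :: real and i j
    proof -
      have "t0 + int i - 1 - (t0 + int j) = int (i - 1 - j)"
        using that by (simp add: of_nat_diff)
      then show ?thesis
        by (simp only: power_int_of_nat)
    qed
    have a_le: "a i \<le> c1 * lam ^ i * norm \<phi>0
        + (\<Sum>j<i. c1 * lam ^ (i - 1 - j) * (R j + \<mu> * (a j + b j)))" for i
    proof -
      have "a i \<le> c1 * lam1 ^ i * norm \<phi>0
        + (\<Sum>j<i. c1 * lam1 powi (t0 + int i - 1 - (t0 + int j)) *
             (\<bar>ref_signal p ys (t0 + int j)\<bar> + \<bar>d (t0 + int j) + d\<Delta> (t0 + int j)\<bar>))"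
        using nominal_bound_arbitrary_disturbance[OF assms(1,2) \<theta>0 assms(9) \<theta>s ys cl, of "t0 + int i"]
        by (simp add: a_def sum_int_shift)
      also have "\<dots> \<le> c1 * lam ^ i * norm \<phi>0
        + (\<Sum>j<i. c1 * lam ^ (i - 1 - j) * (R j + \<mu> * (a j + b j)))"
      proof (intro add_mono sum_mono)
        show "c1 * lam1 ^ i * norm \<phi>0 \<le> c1 * lam ^ i * norm \<phi>0"
          using lam1 assms(7) by (intro mult_right_mono mult_left_mono power_mono) (auto simp: lam_def)
      next
        fix j assume "j \<in> {..<i}"
        then have j: "j < i"
          by simp
        have "\<bar>d\<Delta> (t0 + int j)\<bar> \<le> \<mu> * m (t0 + int j) + \<mu> * a j"
          using d\<Delta> by (simp add: a_def)
        also have "\<dots> \<le> \<mu> * (a j + b j)"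
          using \<mu> by (simp add: b_def distrib_left)
        finally have "\<bar>ref_signal p ys (t0 + int j)\<bar> + \<bar>d (t0 + int j) + d\<Delta> (t0 + int j)\<bar>
            \<le> R j + \<mu> * (a j + b j)"
          by (simp add: R_def)
        moreover have "lam1 ^ (i - 1 - j) \<le> lam ^ (i - 1 - j)"
          using lam1 by (intro power_mono) (auto simp: lam_def)
        ultimately show "c1 * lam1 powi (t0 + int i - 1 - (t0 + int j)) *
             (\<bar>ref_signal p ys (t0 + int j)\<bar> + \<bar>d (t0 + int j) + d\<Delta> (t0 + int j)\<bar>)
           \<le> c1 * lam ^ (i - 1 - j) * (R j + \<mu> * (a j + b j))"
          unfolding powi[OF j] using assms(7) lam by (intro mult_mono mult_left_mono) auto
      qed
      finally show ?thesis .
    qed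
    have b_le: "b (Suc i) \<le> lam * b i + a i" for i
    proof -
      have "m (t0 + int (Suc i)) = \<beta> * m (t0 + int i) + \<beta> * a i"
        using m[rule_format, of "t0 + int i"] by (simp add: a_def add_ac)
      then have "b (Suc i) \<le> \<bar>\<beta> * m (t0 + int i)\<bar> + \<bar>\<beta> * a i\<bar>"
        unfolding b_def by (metis abs_triangle_ineq)
      also have "\<dots> = \<beta> * b i + \<beta> * a i"
        using assms(10) by (simp add: b_def a_def abs_mult)
      \<comment> \<open>\<beta> is enlarged to \<open>lam\<close> in front of b and to 1 in front of
        a, the form of the recursion used in the coupled estimate.\<close>
      also have "\<dots> \<le> lam * b i + 1 * a i"
        using assms(10,11) by (intro add_mono mult_right_mono) (auto simp: lam_def a_def b_def)
      finally show ?thesis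
        by simp
    qed
    have \<mu>_small: "c1 * \<mu> \<le> \<gamma>" "c1 * \<mu> \<le> 2 * \<gamma>\<^sup>2"
      using \<mu> assms(7) by (auto simp: \<mu>bar_def field_simps)
    have lam2: "0 < lam2"
      using lam \<gamma> lam2_eq by simp
    define i where "i = nat (k - t0)"
    have k_eq: "k = t0 + int i"
      using k by (simp add: i_def)
    have "a i \<le> lam2 ^ i * (c1 * norm \<phi>0 + \<gamma> * b 0) + (\<Sum>j<i. c1 * lam2 ^ (i - 1 - j) * R j)"
      by (rule discrete_gronwall_coupled[where lam = lam and \<mu> = \<mu>])
         (use \<gamma> assms(7) lam lam2_eq \<mu> \<mu>_small a_le b_le in \<open>auto simp: a_def b_def\<close>)
    also have "\<dots> \<le> lam2 ^ i * ((c1 + \<gamma>) * (norm \<phi>0 + \<bar>m0\<bar>))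
        + (\<Sum>j<i. (c1 + \<gamma>) * lam2 ^ (i - 1 - j) * R j)"
    proof (intro add_mono mult_left_mono sum_mono mult_right_mono)
      show "c1 * norm \<phi>0 + \<gamma> * b 0 \<le> (c1 + \<gamma>) * (norm \<phi>0 + \<bar>m0\<bar>)"
        using \<gamma> assms(7) by (simp add: b_def m0 distrib_left distrib_right)
    qed (use \<gamma> lam2 in \<open>auto simp: R_def\<close>)
    also have "(\<Sum>j<i. (c1 + \<gamma>) * lam2 ^ (i - 1 - j) * R j)
        = (\<Sum>j=t0..k-1. (c1 + \<gamma>) * lam2 powi (k - 1 - j) * (\<bar>d j\<bar> + \<bar>ref_signal p ys j\<bar>))"
      unfolding k_eq sum_int_shift by (rule sum.cong) (simp_all only: powi lessThan_iff R_def)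
    finally show ?thesis
      by (simp add: a_def k_eq mult_ac)
  qed
  show ?thesis
    using \<mu>bar assms(7) \<gamma> main by (intro exI[of _ \<mu>bar] exI[of _ "c1 + \<gamma>"] conjI allI ballI impI) auto
qed

end
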